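(* Let $T$ be a tree on $n$ vertices with $p$ leaves, and let $B$ be a basis of the row space of $\mathfrak{D}_2(T)$ of the following form: letting $B_1,\dots,B_{n-p}$ be the blocks of the line graph $\mathrm{LG}(T)$, choose for each $j$ an edge $f'_j$ of $\mathrm{LG}(T)$ lying in $B_j$ (so $f'_j$ is a pair of edges of $T$ sharing a vertex), let $f_j$ be the symmetric difference of the endpoint sets of these two edges of $T$ (a 2-element vertex set), and set $B=\{e_1,\dots,e_{n-1},f_1,\dots,f_{n-p}\}$ where $e_1,\dots,e_{n-1}$ are the edges of $T$. Let $P=\mathfrak{D}_2(T)[B,B]$ and write $\det(xI-P)=\sum_{k=0}^{2n-p-1}a_kx^k$. Then the sequence $|a_0|,|a_1|,\ldots,|a_{2n-p-2}|$ is unimodal and log-concave.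
   Context: Let $\mathcal{V}_2$ be the set of 2-element subsets of the vertex set of $T$ (edges are regarded as elements of $\mathcal{V}_2$). The 2-Steiner distance matrix $\mathfrak{D}_2(T)$ is the $\binom n2\times\binom n2$ matrix indexed by $\mathcal{V}_2$ whose entry in row $\{i,j\}$ and column $\{k,l\}$ is the minimum number of edges of a connected subtree of $T$ whose vertex set contains $i,j,k,l$. $M[B,B]$ denotes the principal submatrix with rows and columns indexed by $B$. (Such a $B$ is a basis of the row space of $\mathfrak{D}_2(T)$, which has rank $2n-p-1$.) A sequence is unimodal if it weakly increases up to some index and weakly decreases afterwards; it is log-concave if $a_i^2\ge a_{i-1}a_{i+1}$ for all interior indices $i$. *)

theory Defs
  imports "Jordan_Normal_Form.Char_Poly"
begin

(* adjacency relation of a simple graph given by a set of 2-element edges *)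
definition adj_rel :: "'a set set \<Rightarrow> ('a \<times> 'a) set" where
  "adj_rel E = {(x, y). {x, y} \<in> E \<and> x \<noteq> y}"

(* the subgraph induced on X by relation R is connected *)
definition connected_on :: "'a set \<Rightarrow> ('a \<times> 'a) set \<Rightarrow> bool" where
  "connected_on X R \<longleftrightarrow> (\<forall>u\<in>X. \<forall>v\<in>X. (u, v) \<in> (R \<inter> (X \<times> X))\<^sup>*)"

(* simple graph with vertex set V and edge set E *)
definition simple_graph :: "'a set \<Rightarrow> 'a set set \<Rightarrow> bool" where
  "simple_graph V E \<longleftrightarrow> finite V \<and> (\<forall>e\<in>E. e \<subseteq> V \<and> card e = 2)"

(* tree: connected and minimally connected (every edge is a bridge), i.e. connected acyclic *)
definition is_tree :: "'a set \<Rightarrow> 'a set set \<Rightarrow> bool" where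
  "is_tree V E \<longleftrightarrow> simple_graph V E \<and> V \<noteq> {} \<and> connected_on V (adj_rel E)
     \<and> (\<forall>e\<in>E. \<not> connected_on V (adj_rel (E - {e})))"

definition degree :: "'a set set \<Rightarrow> 'a \<Rightarrow> nat" where
  "degree E v = card {e\<in>E. v \<in> e}"

definition leaves :: "'a set \<Rightarrow> 'a set set \<Rightarrow> 'a set" where
  "leaves V E = {v\<in>V. degree E v = 1}"

(* line graph: vertices are the edges of T, adjacent iff distinct and sharing a vertex *)
definition LG_rel :: "'a set set \<Rightarrow> ('a set \<times> 'a set) set" where
  "LG_rel E = {(e, e'). e \<in> E \<and> e' \<in> E \<and> e \<noteq> e' \<and> e \<inter> e' \<noteq> {}}"

(* connected with no cut vertex (as induced subgraph) *)
definition no_cut :: "'b set \<Rightarrow> ('b \<times> 'b) set \<Rightarrow> bool" where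
  "no_cut Y R \<longleftrightarrow> connected_on Y R \<and> (\<forall>y\<in>Y. connected_on (Y - {y}) R)"

(* block (with at least one edge): maximal connected induced subgraph without cut vertex *)
definition is_block :: "'b set \<Rightarrow> ('b \<times> 'b) set \<Rightarrow> 'b set \<Rightarrow> bool" where
  "is_block W R X \<longleftrightarrow> X \<subseteq> W \<and> card X \<ge> 2 \<and> no_cut X R
     \<and> (\<forall>Y. X \<subset> Y \<and> Y \<subseteq> W \<longrightarrow> \<not> no_cut Y R)"

(* Steiner distance of a vertex set S: minimum number of edges of a connected subtree
   of T whose vertex set contains S (S has at least two vertices here) *)
definition steiner_dist :: "'a set set \<Rightarrow> 'a set \<Rightarrow> nat" where
  "steiner_dist E S = Min {card F | F. F \<subseteq> E \<and> S \<subseteq> \<Union>F \<and> connected_on (\<Union>F) (adj_rel F)}"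

(* entry of the 2-Steiner distance matrix at row {i,j}, column {k,l} *)
definition D2 :: "'a set set \<Rightarrow> 'a set \<Rightarrow> 'a set \<Rightarrow> int" where
  "D2 E s t = int (steiner_dist E (s \<union> t))"

definition unimodal_upto :: "nat \<Rightarrow> (nat \<Rightarrow> int) \<Rightarrow> bool" where
  "unimodal_upto N a \<longleftrightarrow> (\<exists>m\<le>N. (\<forall>i j. i \<le> j \<and> j \<le> m \<longrightarrow> a i \<le> a j)
      \<and> (\<forall>i j. m \<le> i \<and> i \<le> j \<and> j \<le> N \<longrightarrow> a j \<le> a i))"

definition log_concave_upto :: "nat \<Rightarrow> (nat \<Rightarrow> int) \<Rightarrow> bool" where
  "log_concave_upto N a \<longleftrightarrow> (\<forall>i. 0 < i \<and> i < N \<longrightarrow> a (i - 1) * a (i + 1) \<le> (a i)\<^sup>2)"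

end

theory Submission
  imports Defs "Jordan_Normal_Form.Schur_Decomposition"
begin

text \<open>
  The Steiner distance of \<open>S\<close> is the number of tree edges separating \<open>S\<close>. If \<open>A\<close> is one of the two
  sides of an edge, the indicator that this edge separates \<open>s \<union> t\<close> equals
  \<open>1 - [s \<subseteq> A][t \<subseteq> A] - [s \<subseteq> V - A][t \<subseteq> V - A]\<close>, so the quadratic form of the 2-Steiner distance
  matrix is a sum over edges of a square of the coordinate sum minus two squares. It is therefore
  nonpositive on the hyperplane where the coordinates sum to \<open>0\<close>, and the symmetric matrix \<open>P\<close> has
  at most one positive eigenvalue. As the trace of \<open>P\<close> is nonnegative,
  \<open>- det (x I - P) = (l - x) \<Prod> (x + s\<^sub>i)\<close> with \<open>s\<^sub>i \<ge> 0\<close> and \<open>\<Sum> s\<^sub>i \<le> l\<close>, and for such products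
  the coefficients below the top one are nonnegative with decreasing ratios, by induction on the
  number of factors.
  The size of \<open>P\<close> is at least \<open>2n - p - 1\<close>, because the star of every inner vertex is a block of the
  line graph, and the pairs chosen from these stars are distinct non-edges.
\<close>

section \<open>Polynomials with one nonnegative root\<close>

lemma coeff_linear_mult:
  "coeff ([:s, 1:] * q) 0 = s * coeff q 0"
  "coeff ([:s, 1:] * q) (Suc k) = s * coeff q (Suc k) + coeff q k"
  for q :: "'a::comm_ring_1 poly"
  by (simp_all add: coeff_pCons)

text \<open>
  The last conjunct says that consecutive ratios of the coefficients decrease. Unlike plain
  log-concavity it survives multiplication by a linear factor, and it needs no discussion of
  vanishing coefficients.
\<close>

lemma one_positive_root_coeffs:
  fixes l :: real
  assumes "\<And>s. s \<in> set ss \<Longrightarrow> 0 \<le> s" and "sum_list ss \<le> l"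
  defines "p \<equiv> [:l, -1:] * (\<Prod>s\<leftarrow>ss. [:s, 1:])"
  shows "(\<forall>k\<le>length ss. 0 \<le> coeff p k) \<and> coeff p (Suc (length ss)) = -1
    \<and> coeff p (length ss) = l - sum_list ss
    \<and> (\<forall>k>Suc (length ss). coeff p k = 0)
    \<and> (\<forall>i j. i \<le> j \<and> j \<le> length ss \<longrightarrow> coeff p i * coeff p (Suc j) \<le> coeff p (Suc i) * coeff p j)"
  using assms(1,2) unfolding p_def
proof (induction ss)
  case Nil
  then show ?case by (auto simp: coeff_pCons split: nat.splits)
next
  case (Cons s ss)
  define q where "q = [:l, -1:] * (\<Prod>s\<leftarrow>ss. [:s, 1:])"
  define c where "c = coeff q"
  define N where "N = length ss"
  have s: "0 \<le> s" using Cons.prems(1) by simp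
  moreover have "sum_list ss \<le> l"
    using Cons.prems(2) s by simp
  then have IH: "\<And>k. k \<le> N \<Longrightarrow> 0 \<le> c k" "c (Suc N) = -1" "c N = l - sum_list ss"
      "\<And>k. k > Suc N \<Longrightarrow> c k = 0"
      "\<And>i j. i \<le> j \<Longrightarrow> j \<le> N \<Longrightarrow> c i * c (Suc j) \<le> c (Suc i) * c j"
    using Cons.IH Cons.prems unfolding q_def c_def N_def by auto
  have p: "[:l, -1:] * (\<Prod>s\<leftarrow>s # ss. [:s, 1:]) = [:s, 1:] * q"
    unfolding q_def by (simp only: list.map prod_list.Cons mult.left_commute)
  define d where "d = coeff ([:s, 1:] * q)"
  have d: "d 0 = s * c 0" "\<And>k. d (Suc k) = s * c (Suc k) + c k"
    unfolding d_def c_def by (simp_all only: coeff_linear_mult)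
  \<comment> \<open>This is \<open>s * c (Suc N) + c N\<close> with \<open>c (Suc N) = -1\<close>.
    The bound by \<open>l\<close> on the sum of the list matters only for the sign of this
    coefficient.\<close>
  have top: "d (Suc N) = l - sum_list (s # ss)"
    using IH d by (simp add: algebra_simps)
  have nonneg: "0 \<le> d k" if "k \<le> Suc N" for k
  proof (cases "k = Suc N")
    case True
    then show ?thesis using top Cons.prems by simp
  next
    case False
    then show ?thesis using that s IH(1) by (cases k) (auto simp: d)
  qed
  have lc: "d i * d (Suc j) \<le> d (Suc i) * d j" if ij: "i \<le> j" "j \<le> Suc N" for i j
  proof -
    consider "i = j" | "i < j" "j = Suc N" | "i < j" "j \<le> N"
      using ij by linarith
    then show ?thesis
    proof cases
      case 1
      then show ?thesis by (simp add: mult.commute)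
    next
      case 2
      have "d (Suc j) = -1" using 2 IH d by simp
      moreover have "0 \<le> d i" "0 \<le> d (Suc i) * d j"
        using nonneg 2 by auto
      ultimately show ?thesis by simp
    next
      case 3
      then obtain j' where j: "j = Suc j'" by (cases j) auto
      have ss: "s * s * (c i * c (Suc j)) \<le> s * s * (c (Suc i) * c j)"
        using IH(5)[of i j] 3 s by (intro mult_left_mono) auto
      show ?thesis
      proof (cases i)
        case 0
        have "0 \<le> s * (c 1 * c j')" "0 \<le> c 0 * c j'"
          using IH(1)[of 1] IH(1)[of j'] IH(1)[of 0] 3 j s by auto
        then show ?thesis using ss 0 j
          by (simp add: d algebra_simps)
      next
        case (Suc i')
        have a: "c i' * c (Suc j') \<le> c (Suc i') * c j'"
          using IH(5)[of i' j'] 3 j Suc by simp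
        \<comment> \<open>After expansion the products \<open>s * c i * c j\<close> cancel, leaving
          \<open>s * c i' * c (Suc j)\<close> against \<open>s * c (Suc i) * c j'\<close>. Both are
          compared with \<open>c i * c j\<close>; the second comparison needs
          \<open>i \<le> j'\<close>, that is \<open>i < j\<close>.\<close>
        have "c i' * c (Suc j) \<le> c i * c j" "c i * c (Suc j') \<le> c (Suc i) * c j'"
          using IH(5)[of i' j] IH(5)[of i j'] 3 j Suc by simp_all
        then have "s * (c i' * c (Suc j)) \<le> s * (c (Suc i) * c j')"
          using s j by (intro mult_left_mono) auto
        then show ?thesis using ss a Suc j
          by (simp add: d algebra_simps)
      qed
    qed
  qed
  show ?case
    unfolding p d_def[symmetric] using nonneg top lc IH d
    by (auto simp: N_def[symmetric] gr0_conv_Suc less_Suc_eq_le elim!: less_natE)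
qed

text \<open>Adjacent indices give log-concavity. Distant ones exclude gaps such as 1, 0, 0, 1, so no
  ascent can follow a strict descent.\<close>

lemma unimodal_log_concave_if_ratio_decreasing:
  fixes a :: "nat \<Rightarrow> int"
  assumes nonneg: "\<And>k. k \<le> N \<Longrightarrow> 0 \<le> a k"
    and ratio: "\<And>i j. i \<le> j \<Longrightarrow> j < N \<Longrightarrow> a i * a (Suc j) \<le> a (Suc i) * a j"
  shows "unimodal_upto N a \<and> log_concave_upto N a"
proof
  show "log_concave_upto N a"
    unfolding log_concave_upto_def
  proof (intro allI impI)
    fix i assume "0 < i \<and> i < N"
    then show "a (i - 1) * a (i + 1) \<le> (a i)\<^sup>2"
      using ratio[of "i - 1" i] by (simp add: power2_eq_square)
  qed
  \<comment> \<open>Strict descents, with \<open>N\<close> as a fallback so that a least index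
    exists for nondecreasing sequences too. That index is the peak.\<close>
  define D where "D = (\<lambda>m. m = N \<or> m < N \<and> a (Suc m) < a m)"
  define m where "m = (LEAST m. D m)"
  have "D N" by (simp add: D_def)
  then have Dm: "D m" and mN: "m \<le> N"
    unfolding m_def by (auto intro: LeastI Least_le)
  have up: "a k \<le> a (Suc k)" if "k < m" for k
    using not_less_Least[of k D] that mN unfolding m_def[symmetric] by (auto simp: D_def)
  have down: "a (Suc k) \<le> a k" if "m \<le> k" "k < N" for k
  proof -
    have am: "a (Suc m) < a m" "0 \<le> a (Suc m)" using Dm that nonneg by (auto simp: D_def)
    have "a m * a (Suc k) \<le> a (Suc m) * a k" using ratio that by blast
    also have "\<dots> \<le> a m * a k" using am that nonneg[of k] by (intro mult_right_mono) auto
    finally show ?thesis using am by simp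
  qed
  have "a i \<le> a j" if "i \<le> j" "j \<le> m" for i j
    using that by (induction j rule: dec_induct) (auto intro: order_trans[OF _ up])
  moreover have "a j \<le> a i" if "m \<le> i" "i \<le> j" "j \<le> N" for i j
    using that(2,1,3) by (induction j rule: dec_induct) (auto intro: order_trans[OF down])
  ultimately show "unimodal_upto N a"
    unfolding unimodal_upto_def using mN by blast
qed

section \<open>Symmetric matrices with at most one positive eigenvalue\<close>

text \<open>On the invariant plane spanned by \<open>p\<close> and \<open>q\<close> the form would
  be positive definite, yet the plane meets the hyperplane of coordinate sum 0 in a nonzero vector.
  The term with \<open>b\<close> lets \<open>q\<close> be a column from a triangular form rather
  than an eigenvector.\<close>

lemma no_positive_invariant_plane:
  fixes a :: "nat \<Rightarrow> nat \<Rightarrow> real"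
  assumes sym: "\<And>i j. i < n \<Longrightarrow> j < n \<Longrightarrow> a i j = a j i"
    and neg: "\<And>x. (\<Sum>i<n. x i) = 0 \<Longrightarrow> (\<Sum>i<n. x i * (\<Sum>j<n. a i j * x j)) \<le> 0"
    and p: "\<And>i. i < n \<Longrightarrow> (\<Sum>j<n. a i j * p j) = l * p i"
    and q: "\<And>i. i < n \<Longrightarrow> (\<Sum>j<n. a i j * q j) = b * p i + m * q i"
    and pos: "0 < l" "0 < m"
    and indep: "\<And>\<alpha> \<beta>. (\<And>i. i < n \<Longrightarrow> \<alpha> * p i + \<beta> * q i = 0) \<Longrightarrow> \<alpha> = 0 \<and> \<beta> = 0"
  shows False
proof -
  define ip where "ip u v = (\<Sum>i<n. u i * v i)" for u v :: "nat \<Rightarrow> real"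
  define ap where "ap u i = (\<Sum>j<n. a i j * u j)" for u i
  have ip_cong: "ip u v = ip u' v'" if "\<And>i. i < n \<Longrightarrow> u i = u' i" "\<And>i. i < n \<Longrightarrow> v i = v' i" for u v u' v'
    unfolding ip_def using that by (intro sum.cong) auto
  have ip_lin: "ip u (\<lambda>i. x * v i + y * w i) = x * ip u v + y * ip u w"
      "ip (\<lambda>i. x * v i + y * w i) u = x * ip v u + y * ip w u" for u v w x y
    unfolding ip_def by (simp_all add: sum.distrib sum_distrib_left algebra_simps)
  have ap_lin: "ap (\<lambda>i. x * v i + y * w i) i = x * ap v i + y * ap w i" for v w x y i
    unfolding ap_def by (simp add: sum.distrib sum_distrib_left algebra_simps)
  have adj: "ip u (ap v) = ip (ap u) v" for u v
  proof -
    have "ip u (ap v) = (\<Sum>i<n. \<Sum>j<n. u i * (a i j * v j))"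
      unfolding ip_def ap_def by (simp add: sum_distrib_left)
    also have "\<dots> = (\<Sum>j<n. \<Sum>i<n. u i * (a i j * v j))" by (rule sum.swap)
    also have "\<dots> = (\<Sum>j<n. \<Sum>i<n. a j i * u i * v j)"
      by (intro sum.cong refl) (simp add: sym)
    also have "\<dots> = ip (ap u) v"
      unfolding ip_def ap_def by (simp add: sum_distrib_right)
    finally show ?thesis .
  qed
  have ip_pos: "0 < ip u u" if "\<exists>i<n. u i \<noteq> 0" for u
    unfolding ip_def using that by (auto intro!: sum_pos2 simp: zero_less_mult_iff)
  have ip_comm: "ip u v = ip v u" for u v
    unfolding ip_def by (simp add: mult.commute)
  have pp: "0 < ip p p"
    using indep[of 1 0] by (intro ip_pos) auto
  define t where "t = ip p q / ip p p"
  define r where "r = (\<lambda>i. 1 * q i + (-t) * p i)"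
  \<comment> \<open>By symmetry, orthogonalising \<open>q\<close> against \<open>p\<close> turns it into a genuine eigenvector.\<close>
  have pr: "ip p r = 0"
    unfolding r_def ip_lin using pp by (simp add: t_def)
  have rr: "0 < ip r r"
    using indep[of "-t" 1] by (intro ip_pos) (auto simp: r_def algebra_simps)
  have ap_p: "ap p i = l * p i" if "i < n" for i
    unfolding ap_def using p that .
  define b' where "b' = b + t * m - t * l"
  have ap_r: "ap r i = b' * p i + m * r i" if "i < n" for i
    unfolding r_def ap_lin using q[OF that] ap_p[OF that]
    by (simp add: ap_def b'_def algebra_simps)
  \<comment> \<open>Evaluating this product directly, and again after moving the matrix over to
    \<open>p\<close>, gives \<open>b' * ip p p = 0\<close>.\<close>
  have "ip p (ap r) = b' * ip p p + m * ip p r"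
    unfolding ip_lin[symmetric] using ap_r by (intro ip_cong) auto
  moreover have "ip p (ap r) = ip (\<lambda>i. l * p i + 0 * p i) r"
    unfolding adj by (intro ip_cong) (auto simp: ap_p)
  ultimately have b': "b' = 0" using pp pr unfolding ip_lin by simp
  have "\<exists>\<alpha> \<beta>. (\<alpha> \<noteq> 0 \<or> \<beta> \<noteq> 0) \<and> \<alpha> * (\<Sum>i<n. p i) + \<beta> * (\<Sum>i<n. r i) = 0"
  proof (cases "(\<Sum>i<n. p i) = 0")
    case True
    then show ?thesis by (intro exI[of _ 1] exI[of _ 0]) auto
  next
    case False
    then show ?thesis by (intro exI[of _ "- (\<Sum>i<n. r i)"] exI[of _ "\<Sum>i<n. p i"]) auto
  qed
  then obtain \<alpha> \<beta> where ab: "\<alpha> \<noteq> 0 \<or> \<beta> \<noteq> 0" "\<alpha> * (\<Sum>i<n. p i) + \<beta> * (\<Sum>i<n. r i) = 0"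
    by blast
  define x where "x = (\<lambda>i. \<alpha> * p i + \<beta> * r i)"
  have "(\<Sum>i<n. x i) = 0"
    using ab(2) unfolding x_def by (simp add: sum.distrib sum_distrib_left)
  then have "ip x (ap x) \<le> 0"
    using neg[of x] unfolding ip_def ap_def by simp
  moreover have "ip x (ap x) = (\<alpha> * l) * ip x p + (\<beta> * m) * ip x r"
    unfolding ip_lin[symmetric]
    by (intro ip_cong refl) (simp add: x_def ap_lin ap_p ap_r b')
  moreover have "ip x p = \<alpha> * ip p p" "ip x r = \<beta> * ip r r"
    unfolding x_def ip_lin using pr ip_comm[of r p] by simp_all
  ultimately have "l * (\<alpha>\<^sup>2 * ip p p) + m * (\<beta>\<^sup>2 * ip r r) \<le> 0"
    by (simp add: power2_eq_square algebra_simps)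
  moreover have "0 < l * (\<alpha>\<^sup>2 * ip p p) + m * (\<beta>\<^sup>2 * ip r r)"
    using ab(1) pp rr pos by (auto intro: add_pos_nonneg add_nonneg_pos)
  ultimately show False by simp
qed

text \<open>Symmetry makes \<open>e * S\<close> equal to its own conjugate, where \<open>S\<close>
  is the squared norm of an eigenvector and hence real and nonzero.\<close>

lemma symmetric_mat_eigenvalue_real:
  fixes A :: "real mat"
  assumes A: "A \<in> carrier_mat n n"
    and sym: "\<And>i j. i < n \<Longrightarrow> j < n \<Longrightarrow> A $$ (i, j) = A $$ (j, i)"
    and e: "eigenvalue (map_mat complex_of_real A) e"
  shows "e \<in> \<real>"
proof -
  let ?A = "map_mat complex_of_real A"
  obtain v where v: "v \<in> carrier_vec n" "v \<noteq> 0\<^sub>v n" "?A *\<^sub>v v = e \<cdot>\<^sub>v v"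
    using e A unfolding eigenvalue_def eigenvector_def by auto
  have ev: "(\<Sum>j<n. complex_of_real (A $$ (i, j)) * v $ j) = e * v $ i" if "i < n" for i
    using arg_cong[OF v(3), of "\<lambda>w. w $ i"] that A v(1)
    by (simp add: scalar_prod_def atLeast0LessThan)
  define S where "S = (\<Sum>i<n. cnj (v $ i) * v $ i)"
  have "e * S = (\<Sum>i<n. cnj (v $ i) * (\<Sum>j<n. complex_of_real (A $$ (i, j)) * v $ j))"
    unfolding S_def using ev by (simp add: sum_distrib_left algebra_simps)
  also have "\<dots> = (\<Sum>i<n. \<Sum>j<n. cnj (v $ i) * complex_of_real (A $$ (i, j)) * v $ j)"
    by (simp add: sum_distrib_left algebra_simps)
  finally have 1: "e * S = \<dots>" .
  have "cnj (e * S) = (\<Sum>i<n. \<Sum>j<n. v $ i * complex_of_real (A $$ (i, j)) * cnj (v $ j))"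
    unfolding 1 by simp
  also have "\<dots> = (\<Sum>j<n. \<Sum>i<n. v $ i * complex_of_real (A $$ (i, j)) * cnj (v $ j))"
    by (rule sum.swap)
  also have "\<dots> = e * S"
    unfolding 1 by (intro sum.cong refl) (simp add: sym)
  finally have "cnj (e * S) = e * S" .
  moreover have S: "S = complex_of_real (\<Sum>i<n. (cmod (v $ i))\<^sup>2)"
    unfolding S_def by (simp add: complex_norm_square mult.commute flip: of_real_power)
  ultimately have "cnj e * S = e * S" by simp
  moreover have "S \<noteq> 0"
  proof -
    obtain i where "i < n" "v $ i \<noteq> 0"
      using v(1,2) by (metis carrier_vecD eq_vecI index_zero_vec(1,2))
    then have "0 < (\<Sum>i<n. (cmod (v $ i))\<^sup>2)" by (intro sum_pos2[of _ i]) auto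
    then show ?thesis unfolding S by (metis of_real_eq_0_iff less_irrefl)
  qed
  ultimately show ?thesis by (simp add: Reals_cnj_iff)
qed

text \<open>All complex roots are real, so the complex factorisation is the image of a real one
  under an injective map.\<close>

lemma symmetric_mat_char_poly_splits:
  fixes A :: "real mat"
  assumes A: "A \<in> carrier_mat n n"
    and sym: "\<And>i j. i < n \<Longrightarrow> j < n \<Longrightarrow> A $$ (i, j) = A $$ (j, i)"
  obtains es where "char_poly A = (\<Prod>e\<leftarrow>es. [:- e, 1:])" "length es = n"
proof -
  interpret hom: map_poly_inj_idom_hom complex_of_real ..
  let ?A = "map_mat complex_of_real A"
  have cA: "?A \<in> carrier_mat n n" using A by simp
  obtain as where as: "char_poly ?A = (\<Prod>a\<leftarrow>as. [:- a, 1:])" "length as = n"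
    using char_poly_factorized[OF cA] by blast
  have "a \<in> \<real>" if "a \<in> set as" for a
    using symmetric_mat_eigenvalue_real[OF A sym] eigenvalue_root_char_poly[OF cA]
      linear_poly_root[OF that] as(1) by simp
  then have as_Re: "map complex_of_real (map Re as) = as"
    by (auto simp: map_idI)
  have "map_poly complex_of_real (char_poly A) = (\<Prod>a\<leftarrow>map complex_of_real (map Re as). [:- a, 1:])"
    unfolding as_Re as(1)[symmetric] by (rule of_real_hom.char_poly_hom[OF A, symmetric])
  also have "\<dots> = map_poly complex_of_real (\<Prod>a\<leftarrow>map Re as. [:- a, 1:])"
    by (simp add: hom.hom_prod_list o_def)
  finally have "char_poly A = (\<Prod>a\<leftarrow>map Re as. [:- a, 1:])"
    by (rule hom.injectivity)
  then show ?thesis by (rule that) (simp add: as(2))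
qed

lemma trace_mult_commute:
  fixes A B :: "'a::comm_semiring_0 mat"
  assumes "A \<in> carrier_mat n n" "B \<in> carrier_mat n n"
  shows "(\<Sum>i<n. (A * B) $$ (i, i)) = (\<Sum>i<n. (B * A) $$ (i, i))"
proof -
  have "(\<Sum>i<n. (A * B) $$ (i, i)) = (\<Sum>i<n. \<Sum>j<n. A $$ (i, j) * B $$ (j, i))"
    using assms by (intro sum.cong) (auto simp: scalar_prod_def atLeast0LessThan)
  also have "\<dots> = (\<Sum>j<n. \<Sum>i<n. A $$ (i, j) * B $$ (j, i))" by (rule sum.swap)
  also have "\<dots> = (\<Sum>i<n. (B * A) $$ (i, i))"
    using assms by (intro sum.cong) (auto simp: scalar_prod_def atLeast0LessThan mult.commute)
  finally show ?thesis .
qed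

text \<open>Two positive eigenvalues could be placed first on the diagonal of a Schur form, and the
  first two columns of \<open>P\<close> would span a plane excluded by
  \<open>no_positive_invariant_plane\<close>. The trace then bounds the remaining eigenvalues by the
  first.\<close>

lemma char_poly_one_positive_root:
  fixes A :: "real mat"
  assumes A: "A \<in> carrier_mat n n" and n: "0 < n"
    and sym: "\<And>i j. i < n \<Longrightarrow> j < n \<Longrightarrow> A $$ (i, j) = A $$ (j, i)"
    and neg: "\<And>x. (\<Sum>i<n. x i) = 0 \<Longrightarrow> (\<Sum>i<n. x i * (\<Sum>j<n. A $$ (i, j) * x j)) \<le> 0"
    and tr: "0 \<le> (\<Sum>i<n. A $$ (i, i))"
  obtains l ss where "char_poly A = [:- l, 1:] * (\<Prod>s\<leftarrow>ss. [:s, 1:])" "Suc (length ss) = n"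
    "\<And>s. s \<in> set ss \<Longrightarrow> 0 \<le> s" "sum_list ss \<le> l"
proof -
  obtain es0 where es0: "char_poly A = (\<Prod>e\<leftarrow>es0. [:- e, 1:])" "length es0 = n"
    using symmetric_mat_char_poly_splits[OF A sym] by blast
  \<comment> \<open>The Schur form keeps the order of this list on its diagonal, so positive
    eigenvalues belong to the first columns of \<open>P\<close>.\<close>
  define es where "es = filter (\<lambda>e. 0 < e) es0 @ filter (\<lambda>e. \<not> 0 < e) es0"
  have perm: "mset es = mset es0"
    unfolding es_def by simp
  then have "mset (map (\<lambda>e. [:- e, 1:]) es) = mset (map (\<lambda>e. [:- e, 1:]) es0)"
    by simp
  from arg_cong[OF this, of prod_mset] have es: "char_poly A = (\<Prod>e\<leftarrow>es. [:- e, 1:])"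
    unfolding es0(1) prod_mset_prod_list by simp
  have len: "length es = n"
    using mset_eq_length[OF perm] es0(2) by metis
  obtain B P Q where "schur_decomposition A es = (B, P, Q)"
    by (cases "schur_decomposition A es") auto
  then have wit: "similar_mat_wit A B P Q" and ut: "upper_triangular B" and dB: "diag_mat B = es"
    using schur_decomposition[OF A es] by auto
  have car: "B \<in> carrier_mat n n" "P \<in> carrier_mat n n" "Q \<in> carrier_mat n n"
    and PQ: "Q * P = 1\<^sub>m n" and APBQ: "A = P * B * Q"
    using similar_mat_witD2[OF A wit] by auto
  have Bd: "B $$ (i, i) = es ! i" if "i < n" for i
    unfolding dB[symmetric] using that car(1) by (simp add: diag_mat_def)
  have AP: "A * P = P * B"
    unfolding APBQ using car PQ by (simp add: assoc_mult_mat[of _ n n _ n _ n])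
  have "(\<Sum>i<n. A $$ (i, i)) = (\<Sum>i<n. (Q * (P * B)) $$ (i, i))"
    unfolding APBQ using car by (intro trace_mult_commute) auto
  also have "Q * (P * B) = B"
    using car PQ by (simp add: assoc_mult_mat[of _ n n _ n _ n, symmetric])
  also have "(\<Sum>i<n. B $$ (i, i)) = sum_list es"
    using Bd len by (simp add: sum_list_sum_nth atLeast0LessThan)
  finally have trace: "0 \<le> sum_list es" using tr by simp
  obtain l rest where lr: "es = l # rest"
    using len n by (cases es) auto
  have ev: "(\<Sum>k<n. A $$ (i, k) * P $$ (k, j)) = (\<Sum>k<n. P $$ (i, k) * B $$ (k, j))" if "i < n" "j < n" for i j
    using arg_cong[OF AP, of "\<lambda>M. M $$ (i, j)"] that A car
    by (simp add: scalar_prod_def atLeast0LessThan)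
  have nonpos: "e \<le> 0" if "e \<in> set rest" for e
  proof (rule ccontr)
    assume "\<not> e \<le> 0"
    then have "0 < e" by simp
    with that lr obtain m rest' where two: "es = l # m # rest'" "0 < l" "0 < m"
    proof -
      have "sorted_wrt (\<lambda>x y. 0 < y \<longrightarrow> 0 < x) es"
        unfolding es_def by (auto simp: sorted_wrt_append intro: sorted_wrt_mono_rel[of _ "\<lambda>x y. True"])
      then show ?thesis using that lr \<open>e \<in> set rest\<close> \<open>0 < e\<close> by (cases rest) auto
    qed
    then have n2: "2 \<le> n" using len by auto
    \<comment> \<open>These zeros reduce columns 0 and 1 of \<open>A * P = P * B\<close> to the
      hypotheses on \<open>p\<close> and \<open>q\<close>, with \<open>b\<close> being
      \<open>B $$ (0, 1)\<close>.\<close>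
    have B0: "B $$ (k, j) = 0" if "j < k" "k < n" for j k
      using ut that car unfolding upper_triangular_def by auto
    have ev0: "(\<Sum>k<n. A $$ (i, k) * P $$ (k, 0)) = l * P $$ (i, 0)" if "i < n" for i
    proof -
      have "(\<Sum>k<n. P $$ (i, k) * B $$ (k, 0)) = (\<Sum>k\<in>{0}. P $$ (i, k) * B $$ (k, 0))"
        using n2 by (intro sum.mono_neutral_right) (auto simp: B0)
      then show ?thesis using ev[OF that, of 0] Bd[of 0] two n2 by simp
    qed
    have ev1: "(\<Sum>k<n. A $$ (i, k) * P $$ (k, 1)) = B $$ (0, 1) * P $$ (i, 0) + m * P $$ (i, 1)" if "i < n" for i
    proof -
      have "(\<Sum>k<n. P $$ (i, k) * B $$ (k, 1)) = (\<Sum>k\<in>{0, 1}. P $$ (i, k) * B $$ (k, 1))"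
        using n2 by (intro sum.mono_neutral_right) (auto simp: B0)
      then show ?thesis using ev[OF that, of 1] Bd[of 1] two n2 by simp
    qed
    have indep: "\<alpha> = 0 \<and> \<beta> = 0" if z: "\<And>i. i < n \<Longrightarrow> \<alpha> * P $$ (i, 0) + \<beta> * P $$ (i, 1) = 0" for \<alpha> \<beta>
    proof -
      \<comment> \<open>Rows 0 and 1 of the inverse \<open>Q\<close>, applied to the vanishing
        combination, isolate \<alpha> and \<beta>.\<close>
      have QP: "(\<Sum>k<n. Q $$ (i, k) * P $$ (k, j)) = (if i = j then 1 else 0)" if "i < n" "j < n" for i j
        using arg_cong[OF PQ, of "\<lambda>M. M $$ (i, j)"] that car
        by (simp add: scalar_prod_def atLeast0LessThan)
      have "\<alpha> * (\<Sum>k<n. Q $$ (i, k) * P $$ (k, 0)) + \<beta> * (\<Sum>k<n. Q $$ (i, k) * P $$ (k, 1)) = 0" for i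
      proof -
        have "\<alpha> * (\<Sum>k<n. Q $$ (i, k) * P $$ (k, 0)) + \<beta> * (\<Sum>k<n. Q $$ (i, k) * P $$ (k, 1))
          = (\<Sum>k<n. Q $$ (i, k) * (\<alpha> * P $$ (k, 0) + \<beta> * P $$ (k, 1)))"
          by (simp add: sum_distrib_left sum.distrib algebra_simps)
        also have "\<dots> = 0" using z by simp
        finally show ?thesis .
      qed
      from this[of 0] this[of 1] show ?thesis using QP[of 0 0] QP[of 0 1] QP[of 1 0] QP[of 1 1] n2 by simp
    qed
    show False
      by (rule no_positive_invariant_plane[of n "\<lambda>i j. A $$ (i, j)" "\<lambda>i. P $$ (i, 0)" l
            "\<lambda>i. P $$ (i, 1)" "B $$ (0, 1)" m, OF sym neg ev0 ev1 two(2,3) indep])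
  qed
  have "sum_list (map uminus rest) = - sum_list rest"
    by (induction rest) auto
  with trace lr have "sum_list (map uminus rest) \<le> l" by simp
  moreover have "char_poly A = [:- l, 1:] * (\<Prod>s\<leftarrow>map uminus rest. [:s, 1:])"
    unfolding es lr by (simp add: o_def)
  ultimately show ?thesis
    using len lr nonpos by (intro that[of l "map uminus rest"]) auto
qed

lemma char_poly_unimodal_log_concave:
  fixes A :: "int mat"
  assumes A: "A \<in> carrier_mat n n" and M: "M < n"
    and sym: "\<And>i j. i < n \<Longrightarrow> j < n \<Longrightarrow> A $$ (i, j) = A $$ (j, i)"
    and neg: "\<And>x :: nat \<Rightarrow> real. (\<Sum>i<n. x i) = 0 \<Longrightarrow>
      (\<Sum>i<n. x i * (\<Sum>j<n. real_of_int (A $$ (i, j)) * x j)) \<le> 0"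
    and tr: "\<And>i. i < n \<Longrightarrow> 0 \<le> A $$ (i, i)"
  defines "a \<equiv> \<lambda>k. \<bar>coeff (char_poly A) k\<bar>"
  shows "unimodal_upto M a \<and> log_concave_upto M a"
proof -
  let ?A = "map_mat real_of_int A"
  have cA: "?A \<in> carrier_mat n n" using A by simp
  obtain l ss where ls: "char_poly ?A = [:- l, 1:] * (\<Prod>s\<leftarrow>ss. [:s, 1:])" "Suc (length ss) = n"
    "\<And>s. s \<in> set ss \<Longrightarrow> 0 \<le> s" "sum_list ss \<le> l"
    by (rule char_poly_one_positive_root[OF cA])
      (use A M sym neg tr in \<open>auto intro!: sum_nonneg\<close>)
  \<comment> \<open>The negated characteristic polynomial. Only its leading coefficient, in degree
    \<open>n\<close>, is negative; the others are therefore the absolute values \<open>a k\<close>,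
    and \<open>M < n\<close> stays among them.\<close>
  define p where "p = [:l, -1:] * (\<Prod>s\<leftarrow>ss. [:s, 1:])"
  have "char_poly ?A = - p"
    unfolding ls(1) p_def by (simp flip: mult_minus_left)
  then have "map_poly real_of_int (char_poly A) = - p"
    using of_int_hom.char_poly_hom[OF A] by metis
  then have c: "real_of_int (coeff (char_poly A) k) = - coeff p k" for k
    by (metis coeff_minus of_int_hom.coeff_map_poly_hom)
  note b = one_positive_root_coeffs[OF ls(3,4), folded p_def]
  have a: "real_of_int (a k) = coeff p k" if "k < n" for k
  proof -
    have "0 \<le> coeff p k" using b that ls(2) by (simp add: less_Suc_eq_le)
    then show ?thesis using c[of k] unfolding a_def by (simp flip: of_int_abs)
  qed
  show ?thesis
  proof (rule unimodal_log_concave_if_ratio_decreasing)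
    show "a i * a (Suc j) \<le> a (Suc i) * a j" if "i \<le> j" "j < M" for i j
    proof -
      have "real_of_int (a i * a (Suc j)) \<le> real_of_int (a (Suc i) * a j)"
        using b a that M ls(2) by simp
      then show ?thesis by linarith
    qed
  qed (simp add: a_def)
qed

section \<open>Steiner distances and line graph blocks of trees\<close>

lemma adj_rel_mono: "F \<subseteq> G \<Longrightarrow> (adj_rel F)\<^sup>* \<subseteq> (adj_rel G)\<^sup>*"
  by (intro rtrancl_mono) (auto simp: adj_rel_def)

lemma adj_rel_rtrancl_sym: "(u, v) \<in> (adj_rel F)\<^sup>* \<Longrightarrow> (v, u) \<in> (adj_rel F)\<^sup>*"
proof -
  have "sym (adj_rel F)" by (auto simp: sym_def adj_rel_def insert_commute)
  then show "(u, v) \<in> (adj_rel F)\<^sup>* \<Longrightarrow> (v, u) \<in> (adj_rel F)\<^sup>*"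
    using sym_rtrancl by (auto dest: symD)
qed

lemma adj_rel_edge: "{x, y} \<in> F \<Longrightarrow> (x, y) \<in> (adj_rel F)\<^sup>*"
  by (cases "x = y") (auto simp: adj_rel_def)

lemma connected_on_iff:
  assumes "adj_rel F \<subseteq> X \<times> X"
  shows "connected_on X (adj_rel F) \<longleftrightarrow> (\<forall>u\<in>X. \<forall>v\<in>X. (u, v) \<in> (adj_rel F)\<^sup>*)"
  using assms unfolding connected_on_def by (simp add: Int_absorb2)

text \<open>If a walk uses the edge, keep the pieces before its first and after its last use. Uses
  in the same direction give one of the last two alternatives; in opposite directions the pieces
  meet at an end of the edge.\<close>

lemma reachable_remove_edge:
  assumes "(u, v) \<in> (adj_rel F)\<^sup>*"
  shows "(u, v) \<in> (adj_rel (F - {{x, y}}))\<^sup>*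
    \<or> (u, x) \<in> (adj_rel (F - {{x, y}}))\<^sup>* \<and> (y, v) \<in> (adj_rel (F - {{x, y}}))\<^sup>*
    \<or> (u, y) \<in> (adj_rel (F - {{x, y}}))\<^sup>* \<and> (x, v) \<in> (adj_rel (F - {{x, y}}))\<^sup>*"
  using assms
proof (induction rule: rtrancl_induct)
  case base
  then show ?case by simp
next
  case (step v w)
  show ?case
  proof (cases "{v, w} = {x, y}")
    case True
    then have "v = x \<and> w = y \<or> v = y \<and> w = x" by (auto simp: doubleton_eq_iff)
    then show ?thesis using step.IH by auto
  next
    case False
    then have "(v, w) \<in> adj_rel (F - {{x, y}})"
      using step.hyps by (auto simp: adj_rel_def)
    then show ?thesis using step.IH by (meson rtrancl.rtrancl_into_rtrancl)
  qed
qed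

text \<open>Send each vertex other than \<open>r\<close> to an edge towards a neighbour nearer to
  \<open>r\<close>. Two vertices sharing that edge would each be nearer than the other.\<close>

lemma connected_card_edges:
  assumes conn: "connected_on V (adj_rel E)" and fin: "finite E"
    and r: "r \<in> V"
  shows "card (V - {r}) \<le> card E"
proof -
  define d where "d v = (LEAST k. (r, v) \<in> adj_rel E ^^ k)" for v
  have "\<exists>w. {w, v} \<in> E \<and> d w < d v" if v: "v \<in> V - {r}" for v
  proof -
    have "(r, v) \<in> (adj_rel E)\<^sup>*"
      using conn v r rtrancl_mono[of "adj_rel E \<inter> V \<times> V" "adj_rel E"]
      unfolding connected_on_def by blast
    then obtain k where "(r, v) \<in> adj_rel E ^^ k"
      using rtrancl_imp_relpow by blast
    then have dv: "(r, v) \<in> adj_rel E ^^ d v"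
      unfolding d_def by (rule LeastI)
    have "d v \<noteq> 0" using dv v by (intro notI) simp
    then obtain k where k: "d v = Suc k" using not0_implies_Suc by blast
    then obtain w where w: "(r, w) \<in> adj_rel E ^^ k" "(w, v) \<in> adj_rel E"
      using dv by auto
    have "d w \<le> k" unfolding d_def by (rule Least_le) (rule w)
    then show ?thesis using w(2) k by (intro exI[of _ w]) (auto simp: adj_rel_def)
  qed
  then obtain w where w: "\<And>v. v \<in> V - {r} \<Longrightarrow> {w v, v} \<in> E \<and> d (w v) < d v" by metis
  have "inj_on (\<lambda>v. {w v, v}) (V - {r})"
  proof (rule inj_onI, rule ccontr)
    fix u v assume uv: "u \<in> V - {r}" "v \<in> V - {r}" "{w u, u} = {w v, v}" "u \<noteq> v"
    then have "w u = v" "w v = u" by (auto simp: doubleton_eq_iff)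
    then show False using w[OF uv(1)] w[OF uv(2)] by simp
  qed
  then show ?thesis using w fin by (intro card_inj_on_le[of "\<lambda>v. {w v, v}"]) auto
qed

text \<open>In a tree, for at least two vertices, this is the edge set of the smallest subtree
  containing \<open>S\<close>, described without paths.\<close>

definition separating :: "'a set set \<Rightarrow> 'a set \<Rightarrow> 'a set set" where
  "separating E S = {e \<in> E. \<exists>u\<in>S. \<exists>v\<in>S. (u, v) \<notin> (adj_rel (E - {e}))\<^sup>*}"

lemma separating_pair_iff:
  "e \<in> separating E {u, v} \<longleftrightarrow> e \<in> E \<and> (u, v) \<notin> (adj_rel (E - {e}))\<^sup>*"
  unfolding separating_def by (auto dest: adj_rel_rtrancl_sym)

section \<open>Steiner distance as the number of separating edges\<close>

locale tree =
  fixes V :: "'a set" and E :: "'a set set"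
  assumes tree: "is_tree V E"
begin

lemma finV: "finite V" and VE: "e \<in> E \<Longrightarrow> e \<subseteq> V" and card2: "e \<in> E \<Longrightarrow> card e = 2"
  using tree unfolding is_tree_def simple_graph_def by auto

lemma finE: "finite E"
  using finV VE by (meson Pow_iff finite_Pow_iff finite_subset subsetI)

lemma edge_cases: assumes "e \<in> E" obtains x y where "e = {x, y}" "x \<noteq> y" "x \<in> V" "y \<in> V"
  using card2[OF assms] VE[OF assms] unfolding card_2_iff by auto

lemma edge_distinct: "{x, y} \<in> E \<Longrightarrow> x \<noteq> y"
  using card2 by fastforce

lemma adj_rel_sub: "F \<subseteq> E \<Longrightarrow> adj_rel F \<subseteq> V \<times> V"
  using VE unfolding adj_rel_def by auto

lemma reachable: "u \<in> V \<Longrightarrow> v \<in> V \<Longrightarrow> (u, v) \<in> (adj_rel E)\<^sup>*"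
  using tree unfolding is_tree_def by (auto simp: connected_on_iff[OF adj_rel_sub])

lemma bridge:
  assumes "{x, y} \<in> E"
  shows "(x, y) \<notin> (adj_rel (E - {{x, y}}))\<^sup>*"
proof
  assume xy: "(x, y) \<in> (adj_rel (E - {{x, y}}))\<^sup>*"
  have "(u, v) \<in> (adj_rel (E - {{x, y}}))\<^sup>*" if "u \<in> V" "v \<in> V" for u v
    using reachable_remove_edge[OF reachable[OF that], of x y] xy adj_rel_rtrancl_sym[OF xy]
    by (meson rtrancl_trans)
  then have "connected_on V (adj_rel (E - {{x, y}}))"
    by (subst connected_on_iff[OF adj_rel_sub]) auto
  then show False using tree assms unfolding is_tree_def by blast
qed

text \<open>An inclusion-minimal edge set joining \<open>u\<close> and \<open>v\<close> plays the
  role of the path between them; all its edges separate.\<close>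

lemma reachable_separating: 
  assumes "u \<in> V" "v \<in> V"
  shows "(u, v) \<in> (adj_rel (separating E {u, v}))\<^sup>*"
proof -
  define C where "C = {F. F \<subseteq> E \<and> (u, v) \<in> (adj_rel F)\<^sup>*}"
  have "finite C" "C \<noteq> {}"
    unfolding C_def using finE reachable[OF assms] by auto
  then obtain F where F: "F \<in> C" and min: "\<And>G. G \<in> C \<Longrightarrow> G \<subseteq> F \<Longrightarrow> F = G"
    using finite_has_minimal[of C] by metis
  have "F \<subseteq> separating E {u, v}"
  proof
    fix e assume e: "e \<in> F"
    then have eE: "e \<in> E" using F by (auto simp: C_def)
    then obtain x y where xy: "e = {x, y}" by (rule edge_cases)
    have sub: "(adj_rel (F - {e}))\<^sup>* \<subseteq> (adj_rel (E - {e}))\<^sup>*"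
      using F by (intro adj_rel_mono) (auto simp: C_def)
    have "(u, v) \<notin> (adj_rel (F - {e}))\<^sup>*"
      using min[of "F - {e}"] F e by (auto simp: C_def)
    \<comment> \<open>\<open>F - {e}\<close> does not join \<open>u\<close> and \<open>v\<close>, so
      they hang on opposite ends of \<open>e\<close>. A connection between them in
      \<open>E - {e}\<close> would join these ends, against \<open>bridge\<close>.\<close>
    then have alt: "(u, x) \<in> (adj_rel (E - {e}))\<^sup>* \<and> (y, v) \<in> (adj_rel (E - {e}))\<^sup>*
        \<or> (u, y) \<in> (adj_rel (E - {e}))\<^sup>* \<and> (x, v) \<in> (adj_rel (E - {e}))\<^sup>*"
      using reachable_remove_edge[of u v F x y] F xy sub by (auto simp: C_def)
    have "(u, v) \<notin> (adj_rel (E - {e}))\<^sup>*"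
    proof
      assume "(u, v) \<in> (adj_rel (E - {e}))\<^sup>*"
      then have "(x, y) \<in> (adj_rel (E - {e}))\<^sup>*"
        using alt by (meson adj_rel_rtrancl_sym rtrancl_trans)
      then show False using bridge eE xy by blast
    qed
    then show "e \<in> separating E {u, v}" using eE by (auto simp: separating_def)
  qed
  then show ?thesis using F adj_rel_mono unfolding C_def by blast
qed

text \<open>Pairs from \<open>S\<close> are joined by \<open>reachable_separating\<close>, and every
  end of a separating edge is joined to \<open>S\<close>. Two distinct elements ensure that each
  vertex of \<open>S\<close> lies on an edge.\<close>

lemma separating_connected:
  assumes S: "S \<subseteq> V" and uv: "u \<in> S" "v \<in> S" "u \<noteq> v"
  shows "S \<subseteq> \<Union> (separating E S)" and "connected_on (\<Union> (separating E S)) (adj_rel (separating E S))"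
proof -
  let ?F = "separating E S"
  have S_conn: "(s, t) \<in> (adj_rel ?F)\<^sup>*" if "s \<in> S" "t \<in> S" for s t
  proof -
    have "separating E {s, t} \<subseteq> ?F" using that by (auto simp: separating_def)
    then show ?thesis
      using reachable_separating[of s t] adj_rel_mono that S by blast
  qed
  show "S \<subseteq> \<Union> ?F"
  proof
    fix s assume s: "s \<in> S"
    obtain t where "t \<in> S" "t \<noteq> s" using uv by metis
    then have "(s, t) \<in> (adj_rel ?F)\<^sup>*" "s \<noteq> t" using S_conn s by auto
    then obtain w where "(s, w) \<in> adj_rel ?F" by (meson converse_rtranclE)
    then show "s \<in> \<Union> ?F" by (auto simp: adj_rel_def)
  qed
  have to_S: "\<exists>s\<in>S. (s, x) \<in> (adj_rel ?F)\<^sup>*" if "x \<in> \<Union> ?F" for x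
  proof -
    from that obtain e where e: "e \<in> ?F" "x \<in> e" by auto
    then obtain s t where st: "s \<in> S" "t \<in> S" "(s, t) \<notin> (adj_rel (E - {e}))\<^sup>*" and eE: "e \<in> E"
      by (auto simp: separating_def)
    obtain y where xy: "e = {x, y}" using eE e(2) by (elim edge_cases) auto
    have sub: "(adj_rel (?F - {e}))\<^sup>* \<subseteq> (adj_rel (E - {e}))\<^sup>*" "(adj_rel (?F - {e}))\<^sup>* \<subseteq> (adj_rel ?F)\<^sup>*"
      by (intro adj_rel_mono; auto simp: separating_def)+
    \<comment> \<open>Deleting \<open>e\<close> breaks the connection from \<open>s\<close> to
      \<open>t\<close>, so each end of \<open>e\<close> stays attached to one of them.\<close>
    have "(s, x) \<in> (adj_rel (?F - {e}))\<^sup>* \<or> (x, t) \<in> (adj_rel (?F - {e}))\<^sup>*"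
      using reachable_remove_edge[OF S_conn[OF st(1,2)], of x y] st(3) sub(1) xy by auto
    then show ?thesis using sub(2) st(1,2) adj_rel_rtrancl_sym[of x t ?F] by blast
  qed
  have sub: "adj_rel ?F \<subseteq> \<Union> ?F \<times> \<Union> ?F" by (auto simp: adj_rel_def)
  have "(x, y) \<in> (adj_rel ?F)\<^sup>*" if "x \<in> \<Union> ?F" "y \<in> \<Union> ?F" for x y
  proof -
    obtain s t where st: "s \<in> S" "t \<in> S" "(s, x) \<in> (adj_rel ?F)\<^sup>*" "(t, y) \<in> (adj_rel ?F)\<^sup>*"
      using to_S \<open>x \<in> \<Union> ?F\<close> \<open>y \<in> \<Union> ?F\<close> by blast
    show ?thesis
      using adj_rel_rtrancl_sym[OF st(3)] S_conn[OF st(1,2)] st(4) by (meson rtrancl_trans)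
  qed
  then show "connected_on (\<Union> ?F) (adj_rel ?F)"
    unfolding connected_on_iff[OF sub] by blast
qed

text \<open>The separating edges form an admissible subtree, and every admissible \<open>F\<close>
  contains them: omitting one would disconnect two vertices of \<open>S\<close>.\<close>

lemma steiner_dist_eq_card_separating:
  assumes S: "S \<subseteq> V" and uv: "u \<in> S" "v \<in> S" "u \<noteq> v"
  shows "steiner_dist E S = card (separating E S)"
  unfolding steiner_dist_def
proof (rule Min_eqI)
  have "{card F |F. F \<subseteq> E \<and> S \<subseteq> \<Union> F \<and> connected_on (\<Union> F) (adj_rel F)} \<subseteq> card ` Pow E"
    by auto
  then show "finite {card F |F. F \<subseteq> E \<and> S \<subseteq> \<Union> F \<and> connected_on (\<Union> F) (adj_rel F)}"
    using finE finite_subset by blast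
  show "card (separating E S) \<in> {card F |F. F \<subseteq> E \<and> S \<subseteq> \<Union> F \<and> connected_on (\<Union> F) (adj_rel F)}"
    using separating_connected[OF assms] by (auto simp: separating_def)
next
  fix k assume "k \<in> {card F |F. F \<subseteq> E \<and> S \<subseteq> \<Union> F \<and> connected_on (\<Union> F) (adj_rel F)}"
  then obtain F where F: "k = card F" "F \<subseteq> E" "S \<subseteq> \<Union> F" "connected_on (\<Union> F) (adj_rel F)" by auto
  have sub: "adj_rel F \<subseteq> \<Union> F \<times> \<Union> F" by (auto simp: adj_rel_def)
  have "separating E S \<subseteq> F"
  proof
    fix e assume "e \<in> separating E S"
    then obtain s t where st: "s \<in> S" "t \<in> S" "(s, t) \<notin> (adj_rel (E - {e}))\<^sup>*"
      by (auto simp: separating_def)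
    show "e \<in> F"
    proof (rule ccontr)
      assume "e \<notin> F"
      then have "(adj_rel F)\<^sup>* \<subseteq> (adj_rel (E - {e}))\<^sup>*" using F by (intro adj_rel_mono) auto
      moreover have "(s, t) \<in> (adj_rel F)\<^sup>*"
        using F st unfolding connected_on_iff[OF sub] by blast
      ultimately show False using st by blast
    qed
  qed
  then show "card (separating E S) \<le> k"
    using F finE by (auto intro: card_mono finite_subset)
qed

text \<open>One of the two components left by deleting the edge \<open>e\<close>. The choice of end
  is harmless, as the side and its complement are always treated alike.\<close>

definition side :: "'a set \<Rightarrow> 'a set" where
  "side e = {v \<in> V. ((SOME x. x \<in> e), v) \<in> (adj_rel (E - {e}))\<^sup>*}"

text \<open>Without \<open>e\<close> every vertex still reaches an end of \<open>e\<close>, so all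
  vertices off the side are connected to each other.\<close>

lemma separating_iff_side:
  assumes e: "e \<in> E" and S: "S \<subseteq> V"
  shows "e \<in> separating E S \<longleftrightarrow> \<not> S \<subseteq> side e \<and> \<not> S \<subseteq> V - side e"
proof -
  define x where "x = (SOME x. x \<in> e)"
  have "x \<in> e" unfolding x_def using card2[OF e] by (metis card.empty ex_in_conv someI_ex zero_neq_numeral)
  then obtain y where xy: "e = {x, y}" "x \<in> V" using e by (elim edge_cases) auto
  let ?R = "(adj_rel (E - {e}))\<^sup>*"
  have side: "v \<in> side e \<longleftrightarrow> (x, v) \<in> ?R" if "v \<in> V" for v
    using that unfolding side_def x_def by simp
  have y: "(y, v) \<in> ?R" if "v \<in> V" "(x, v) \<notin> ?R" for v
    using reachable_remove_edge[OF reachable[OF xy(2) that(1)], of x y] that xy(1) by auto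
  have "(u, v) \<in> ?R \<longleftrightarrow> (u \<in> side e \<longleftrightarrow> v \<in> side e)" if uv: "u \<in> V" "v \<in> V" for u v
    using y uv unfolding side[OF uv(1)] side[OF uv(2)]
    by (meson adj_rel_rtrancl_sym rtrancl_trans)
  then show ?thesis using e S unfolding separating_def by blast
qed

lemma steiner_form_nonpos:
  fixes x :: "nat \<Rightarrow> real"
  assumes s: "\<And>i. i < n \<Longrightarrow> s i \<subseteq> V \<and> card (s i) = 2"
    and x: "(\<Sum>i<n. x i) = 0"
  shows "(\<Sum>i<n. x i * (\<Sum>j<n. real_of_int (D2 E (s i) (s j)) * x j)) \<le> 0"
proof -
  define f where "f e i = (if s i \<subseteq> side e then 1 else 0 :: real)" for e i
  define g where "g e i = (if s i \<subseteq> V - side e then 1 else 0 :: real)" for e i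
  have D: "real_of_int (D2 E (s i) (s j)) = (\<Sum>e\<in>E. 1 - f e i * f e j - g e i * g e j)" if "i < n" "j < n" for i j
  proof -
    from s[OF that(1)] obtain u v where uv: "s i = {u, v}" "u \<noteq> v" by (auto simp: card_2_iff)
    have sub: "s i \<union> s j \<subseteq> V" using s that by blast
    have "D2 E (s i) (s j) = int (card (separating E (s i \<union> s j)))"
      unfolding D2_def using steiner_dist_eq_card_separating[OF sub, of u v] uv by simp
    also have "real_of_int \<dots> = (\<Sum>e\<in>E. if e \<in> separating E (s i \<union> s j) then 1 else 0)"
      using finE by (simp add: sum.If_cases separating_def Int_def)
    also have "\<dots> = (\<Sum>e\<in>E. 1 - f e i * f e j - g e i * g e j)"
    proof (intro sum.cong refl)
      fix e assume e: "e \<in> E"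
      \<comment> \<open>The nonempty set \<open>s i\<close> fits into at most one side, so the two
        products are never both 1.\<close>
      have "\<not> (s i \<subseteq> side e \<and> s i \<subseteq> V - side e)" using uv by auto
      then show "(if e \<in> separating E (s i \<union> s j) then 1 else 0) = 1 - f e i * f e j - g e i * g e j"
        unfolding separating_iff_side[OF e sub] Un_subset_iff f_def g_def by (simp del: Diff_subset)
    qed
    finally show ?thesis .
  qed
  have "(\<Sum>i<n. x i * (\<Sum>j<n. real_of_int (D2 E (s i) (s j)) * x j))
    = (\<Sum>i<n. \<Sum>j<n. \<Sum>e\<in>E. x i * x j - (f e i * x i) * (f e j * x j) - (g e i * x i) * (g e j * x j))"
    by (simp add: D sum_distrib_left sum_distrib_right algebra_simps)
  also have "\<dots> = (\<Sum>i<n. \<Sum>e\<in>E. \<Sum>j<n. x i * x j - (f e i * x i) * (f e j * x j) - (g e i * x i) * (g e j * x j))"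
    by (intro sum.cong refl sum.swap)
  also have "\<dots> = (\<Sum>e\<in>E. \<Sum>i<n. \<Sum>j<n. x i * x j - (f e i * x i) * (f e j * x j) - (g e i * x i) * (g e j * x j))"
    by (rule sum.swap)
  also have "\<dots> = (\<Sum>e\<in>E. (\<Sum>i<n. x i)\<^sup>2 - (\<Sum>i<n. f e i * x i)\<^sup>2 - (\<Sum>i<n. g e i * x i)\<^sup>2)"
    by (simp add: sum_subtractf power2_eq_square sum_product)
  also have "\<dots> \<le> 0"
    unfolding x by (intro sum_nonpos) (simp add: power2_eq_square)
  finally show ?thesis .
qed

section \<open>Blocks of the line graph and the size of the index set\<close>

abbreviation star :: "'a \<Rightarrow> 'a set set" where
  "star v \<equiv> {e \<in> E. v \<in> e}"

text \<open>A star is a clique of the line graph. If \<open>Y\<close> also contains an edge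
  \<open>h\<close> missing \<open>v\<close>, the star edge leading towards \<open>h\<close> is a cut
  vertex of \<open>Y\<close>: it separates the other star edges from \<open>h\<close>.\<close>

lemma star_is_block:
  assumes v: "v \<in> V" and deg: "2 \<le> degree E v"
  shows "is_block E (LG_rel E) (star v)"
proof -
  have conn: "connected_on X (LG_rel E)" if "X \<subseteq> star v" for X
    unfolding connected_on_def
  proof (intro ballI)
    fix e e' assume "e \<in> X" "e' \<in> X"
    then show "(e, e') \<in> (LG_rel E \<inter> X \<times> X)\<^sup>*"
      using that by (cases "e = e'") (auto intro!: r_into_rtrancl simp: LG_rel_def)
  qed
  have "\<not> no_cut Y (LG_rel E)" if Y: "star v \<subset> Y" "Y \<subseteq> E" for Y
  proof
    assume nc: "no_cut Y (LG_rel E)"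
    obtain h where h: "h \<in> Y" "v \<notin> h" "h \<in> E" using Y by auto
    obtain c where c: "c \<in> h" "c \<in> V" using h(3) by (elim edge_cases) auto
    then have "(v, c) \<in> (adj_rel (separating E {v, c}))\<^sup>*" "v \<noteq> c"
      using reachable_separating v h by auto
    then obtain w where "(v, w) \<in> adj_rel (separating E {v, c})"
      by (meson converse_rtranclE)
    then have "{v, w} \<in> separating E {v, c}"
      by (simp add: adj_rel_def)
    then obtain e where e: "e \<in> E" "v \<in> e" "(v, c) \<notin> (adj_rel (E - {e}))\<^sup>*"
      unfolding separating_pair_iff by blast
    have "\<not> star v \<subseteq> {e}"
      using deg card_mono[of "{e}" "star v"] unfolding degree_def by auto
    then obtain e' where e': "e' \<in> star v" "e' \<noteq> e" by blast
    have "(e', h) \<in> (LG_rel E \<inter> (Y - {e}) \<times> (Y - {e}))\<^sup>*"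
      using nc e e' h Y unfolding no_cut_def connected_on_def by blast
    \<comment> \<open>Invariant of line graph walks avoiding \<open>e\<close>: both ends of the
      current edge stay connected to \<open>v\<close>. At \<open>h\<close> this contradicts the
      choice of \<open>e\<close>.\<close>
    moreover have "\<forall>z\<in>k. (v, z) \<in> (adj_rel (E - {e}))\<^sup>*"
      if "(e', k) \<in> (LG_rel E \<inter> (Y - {e}) \<times> (Y - {e}))\<^sup>*" for k
      using that
    proof (induction rule: rtrancl_induct)
      have within: "(z, z') \<in> (adj_rel (E - {e}))\<^sup>*" if "k \<in> E - {e}" "z \<in> k" "z' \<in> k" for k z z'
      proof -
        have "z = z' \<or> k = {z, z'}" using that by (auto elim: edge_cases)
        then show ?thesis using that(1) adj_rel_edge[of z z' "E - {e}"] by blast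
      qed
      {
        case base
        show ?case using within[of e' v] e' by auto
      next
        case (step k k')
        obtain z where z: "z \<in> k" "z \<in> k'" using step.hyps(2) by (auto simp: LG_rel_def)
        have "k' \<in> E - {e}" using step.hyps(2) by (auto simp: LG_rel_def)
        then show ?case using within[of k' z] z step.IH by (meson rtrancl_trans)
      }
    qed
    ultimately show False using c e by blast
  qed
  then show ?thesis
    using deg conn unfolding is_block_def no_cut_def degree_def by auto
qed

lemma LG_symdiff:
  assumes "(e, e') \<in> LG_rel E"
  obtains z a b where "e = {z, a}" "e' = {z, b}" "a \<noteq> b" "(e - e') \<union> (e' - e) = {a, b}" "z \<noteq> a" "z \<noteq> b"
proof -
  obtain z where z: "z \<in> e" "z \<in> e'" and E: "e \<in> E" "e' \<in> E" "e \<noteq> e'"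
    using assms by (auto simp: LG_rel_def)
  obtain a where a: "e = {z, a}" "z \<noteq> a" using E(1) z(1) by (elim edge_cases) auto
  obtain b where b: "e' = {z, b}" "z \<noteq> b" using E(2) z(2) by (elim edge_cases) auto
  have "a \<noteq> b" using a b E by auto
  then show ?thesis using that a b by blast
qed

text \<open>The path through \<open>z\<close> would survive deletion of the bridge
  \<open>{a, b}\<close>.\<close>

lemma no_triangle:
  assumes "{z, a} \<in> E" "{z, b} \<in> E" "a \<noteq> b"
  shows "{a, b} \<notin> E"
proof
  assume ab: "{a, b} \<in> E"
  have "{a, z} \<in> E - {{a, b}}" "{z, b} \<in> E - {{a, b}}"
    using assms edge_distinct[of z a] edge_distinct[of z b] by (auto simp: insert_commute doubleton_eq_iff)
  then show False using bridge[OF ab] adj_rel_edge rtrancl_trans by metis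
qed

text \<open>Otherwise the path from \<open>z\<close> through \<open>b\<close> and \<open>y\<close>
  to \<open>a\<close> would bypass the bridge \<open>{z, a}\<close>.\<close>

lemma common_neighbour_unique:
  assumes "{z, a} \<in> E" "{z, b} \<in> E" "{y, a} \<in> E" "{y, b} \<in> E" "a \<noteq> b"
  shows "y = z"
proof (rule ccontr)
  assume "y \<noteq> z"
  then have "{z, b} \<in> E - {{z, a}}" "{b, y} \<in> E - {{z, a}}" "{y, a} \<in> E - {{z, a}}"
    using assms edge_distinct[of z a] edge_distinct[of z b] by (auto simp: insert_commute doubleton_eq_iff)
  from this[THEN adj_rel_edge] show False
    using bridge[OF assms(1)] by (meson rtrancl_trans)
qed

lemma degree_pos:
  assumes "v \<in> V" "2 \<le> card V"
  shows "1 \<le> degree E v"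
proof -
  have "\<not> V \<subseteq> {v}" using assms card_mono[of "{v}" V] by auto
  then obtain u where "u \<in> V" "u \<noteq> v" by blast
  then have "(v, u) \<in> (adj_rel E)\<^sup>*" "v \<noteq> u" using reachable assms by auto
  then obtain w where "(v, w) \<in> adj_rel E" by (meson converse_rtranclE)
  then have "{v, w} \<in> E" by (simp add: adj_rel_def)
  then have "star v \<noteq> {}" by auto
  then show ?thesis unfolding degree_def using finE by (simp add: Suc_le_eq card_gt_0_iff)
qed

text \<open>Pairs from the stars of inner vertices are distinct by
  \<open>common_neighbour_unique\<close> and are non-edges by \<open>no_triangle\<close>. They add
  one element per inner vertex to the at least \<open>card V - 1\<close> edges.\<close>

lemma basis_card:
  assumes n2: "card V \<ge> 2"
    and g: "\<And>X. is_block E (LG_rel E) X \<Longrightarrow>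
              fst (g X) \<in> X \<and> snd (g X) \<in> X \<and> (fst (g X), snd (g X)) \<in> LG_rel E"
    and W: "E \<union> {(fst (g X) - snd (g X)) \<union> (snd (g X) - fst (g X)) | X. is_block E (LG_rel E) X} \<subseteq> W"
    and finW: "finite W"
  shows "2 * card V - card (leaves V E) - 1 \<le> card W"
proof -
  define I where "I = V - leaves V E"
  define f where "f v = (fst (g (star v)) - snd (g (star v))) \<union> (snd (g (star v)) - fst (g (star v)))" for v
  have block: "is_block E (LG_rel E) (star v)" if "v \<in> I" for v
    using that degree_pos[of v] n2 by (intro star_is_block) (auto simp: I_def leaves_def)
  have f: "\<exists>a b. f v = {a, b} \<and> a \<noteq> b \<and> {v, a} \<in> E \<and> {v, b} \<in> E" if v: "v \<in> I" for v
  proof -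
    have gv: "fst (g (star v)) \<in> star v" "snd (g (star v)) \<in> star v"
        "(fst (g (star v)), snd (g (star v))) \<in> LG_rel E"
      using g[OF block[OF v]] by auto
    from gv(3) obtain z a b where zab: "fst (g (star v)) = {z, a}" "snd (g (star v)) = {z, b}" "a \<noteq> b" "f v = {a, b}"
      unfolding f_def by (rule LG_symdiff)
    \<comment> \<open>Both chosen edges contain \<open>v\<close>, but they share only
      \<open>z\<close> because \<open>a \<noteq> b\<close>.\<close>
    then have "v = z" using gv(1,2) by auto
    then show ?thesis using zab gv by auto
  qed
  have "inj_on f I"
  proof (rule inj_onI)
    fix u v assume uv: "u \<in> I" "v \<in> I" "f u = f v"
    obtain a b where ab: "f u = {a, b}" "a \<noteq> b" "{u, a} \<in> E" "{u, b} \<in> E" using f[OF uv(1)] by blast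
    obtain c d where cd: "f v = {c, d}" "{v, c} \<in> E" "{v, d} \<in> E" using f[OF uv(2)] by blast
    have "{v, a} \<in> E" "{v, b} \<in> E" using ab cd uv(3) by (auto simp: doubleton_eq_iff)
    then show "u = v" using common_neighbour_unique ab by metis
  qed
  then have "card (f ` I) = card I" by (rule card_image)
  moreover have "f v \<notin> E" if "v \<in> I" for v
  proof -
    from f[OF that] obtain a b where "f v = {a, b}" "a \<noteq> b" "{v, a} \<in> E" "{v, b} \<in> E" by blast
    then show ?thesis using no_triangle[of v a b] by simp
  qed
  then have "f ` I \<inter> E = {}" by blast
  ultimately have "card (f ` I \<union> E) = card I + card E"
    using finE finV by (simp add: card_Un_disjoint I_def)
  moreover have "f ` I \<union> E \<subseteq> W" using W block unfolding f_def by blast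
  ultimately have "card I + card E \<le> card W" using card_mono[OF finW] by metis
  moreover obtain r where "r \<in> V" using n2 by fastforce
  then have "card V - 1 \<le> card E"
    using connected_card_edges[of V E r] tree finE finV unfolding is_tree_def by auto
  moreover have "card I = card V - card (leaves V E)"
    unfolding I_def using finV by (intro card_Diff_subset) (auto simp: leaves_def)
  ultimately show ?thesis using n2 by linarith
qed

end

theorem theorem1p5:
  fixes V :: "'a set" and E :: "'a set set"
    and g :: "'a set set \<Rightarrow> 'a set \<times> 'a set"
    and bs :: "'a set list"
  assumes tree: "is_tree V E"
    and n2: "card V \<ge> 2"
    and g: "\<And>X. is_block E (LG_rel E) X \<Longrightarrow>
              fst (g X) \<in> X \<and> snd (g X) \<in> X \<and> (fst (g X), snd (g X)) \<in> LG_rel E"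
    and B: "set bs = E \<union> {(fst (g X) - snd (g X)) \<union> (snd (g X) - fst (g X)) | X. is_block E (LG_rel E) X}"
    and dist: "distinct bs"
  shows "let n = card V; p = card (leaves V E);
             P = mat (length bs) (length bs) (\<lambda>(i, j). D2 E (bs ! i) (bs ! j));
             a = (\<lambda>k. \<bar>coeff (char_poly P) k\<bar>)
         in unimodal_upto (2 * n - p - 2) a \<and> log_concave_upto (2 * n - p - 2) a"
proof -
  interpret tree V E by unfold_locales (rule tree)
  define P where "P = mat (length bs) (length bs) (\<lambda>(i, j). D2 E (bs ! i) (bs ! j))"
  define M where "M = 2 * card V - card (leaves V E) - 2"
  have "2 * card V - card (leaves V E) - 1 \<le> card (set bs)"
    by (rule basis_card[OF n2 g]) (use B in \<open>auto simp flip: B\<close>)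
  moreover have "card (leaves V E) \<le> card V"
    using finV by (intro card_mono) (auto simp: leaves_def)
  \<comment> \<open>At most \<open>card V\<close> leaves and \<open>card V \<ge> 2\<close> make the
    truncated subtraction in \<open>M\<close> exact, so \<open>M\<close> is one less than the lower
    bound on the matrix size.\<close>
  ultimately have M: "M < length bs"
    using n2 dist by (simp add: M_def distinct_card)
  have pairs: "s \<subseteq> V \<and> card s = 2" if "s \<in> set bs" for s
  proof (cases "s \<in> E")
    case True
    then show ?thesis using VE card2 by blast
  next
    case False
    then obtain X where X: "is_block E (LG_rel E) X"
      and s: "s = (fst (g X) - snd (g X)) \<union> (snd (g X) - fst (g X))"
      using \<open>s \<in> set bs\<close> B by auto
    have LG: "(fst (g X), snd (g X)) \<in> LG_rel E" using g[OF X] by blast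
    then have "s \<subseteq> V" using VE unfolding s LG_rel_def by blast
    moreover have "card s = 2"
      using LG unfolding s by (rule LG_symdiff) simp
    ultimately show ?thesis ..
  qed
  have "unimodal_upto M (\<lambda>k. \<bar>coeff (char_poly P) k\<bar>) \<and> log_concave_upto M (\<lambda>k. \<bar>coeff (char_poly P) k\<bar>)"
  proof (rule char_poly_unimodal_log_concave[OF _ M])
    show "P \<in> carrier_mat (length bs) (length bs)" by (simp add: P_def)
    show "P $$ (i, j) = P $$ (j, i)" if "i < length bs" "j < length bs" for i j
      using that by (simp add: P_def D2_def Un_commute)
    show "0 \<le> P $$ (i, i)" if "i < length bs" for i
      using that by (simp add: P_def D2_def)
    fix x :: "nat \<Rightarrow> real" assume "(\<Sum>i<length bs. x i) = 0"
    then show "(\<Sum>i<length bs. x i * (\<Sum>j<length bs. real_of_int (P $$ (i, j)) * x j)) \<le> 0"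
      using steiner_form_nonpos[of "length bs" "\<lambda>i. bs ! i" x] pairs by (simp add: P_def)
  qed
  then show ?thesis unfolding Let_def P_def M_def .
qed

end
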